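(* Let $b$ be a positive integer, let $T$ be a tree with at least $2$ vertices, and let $A\subseteq V(T)$. Then the following are equivalent: (i) In the $(b:1)$ game on $T$ in which Staller moves first, Dominator has a strategy, claiming only vertices of $V(T)\setminus A$, to dominate all vertices of $V(T)\setminus N[A]$; (ii) $T$ is $(A,b)$-good.
   Context: The $(b:1)$ game on $T$: Dominator and Staller alternately claim previously unclaimed vertices of $T$; in each of her turns Dominator claims up to $b$ vertices, in each of his turns Staller claims one vertex. A vertex is dominated by Dominator if it or one of its neighbours is claimed by Dominator. $N(v)$ is the neighbourhood of $v$ in $T$, $N[A]=A\cup\bigcup_{a\in A}N(a)$. For a forest $F$, $L(F)$ is its set of leaves (vertices of degree $1$). For a sequence $\mathbf v=(v_1,\dots,v_t)$ of distinct vertices of $V(T)\setminus A$ define $F_0:=T$, $F_i:=F_{i-1}-(\{v_i\}\cup((N(v_i)\cap L(F_{i-1}))\setminus A))$ for $i=1,\dots,t$, and $T_{\downarrow\mathbf v,A}:=F_t$. The sequence $\mathbf v$ is $(A,b)$-admissible for $T$ if $|(N(v_i)\cap L(T_{\downarrow(v_1,\dots,v_{i-1}),A}))\setminus A|=b$ for all $i\in\{1,\dots,t\}$. For $u\notin A$, the sequence $(v_1,\dots,v_t,u)$ is $(A,b)$-problematic for $T$ if $\mathbf v$ is $(A,b)$-admissible for $T$ and $|(N(u)\cap L(T_{\downarrow\mathbf v,A}))\setminus A|\geq b+1$. $T$ is $(A,b)$-good if there is no $(A,b)$-problematic sequence for $T$.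
   Formalization: In an (A,b)-problematic sequence (v_1,…,v_t,u), u must also differ from all v_i; with only u∉A the equivalence fails, e.g. for b=1, A=∅ and a spider with centre v, one leaf and two legs of length 2, where (v,v) would be problematic though Dominator wins. *)

theory Defs
  imports "Graph_Theory.Graph_Theory"
begin

text \<open>
  A finite simple undirected graph is a symmetric digraph without loops and multiple arcs
  (locale \<^locale>\<open>graph\<close>). In such a graph every edge gives a cycle
  \<open>u, v, u\<close> of length two, so the constant \<^const>\<open>tree\<close> of the
  library, which forbids these as well, fails for every symmetric digraph with an arc. Undirected
  cycles are the cycles of length at least three.
\<close>

definition is_tree :: "('a, 'b) pre_digraph \<Rightarrow> bool" where
  "is_tree T \<longleftrightarrow> graph T \<and> connected T \<and> \<not> (\<exists>p. pre_digraph.cycle T p \<and> 3 \<le> length p)"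

definition nbhd :: "('a, 'b) pre_digraph \<Rightarrow> 'a \<Rightarrow> 'a set" where
  "nbhd G v = {w. v \<rightarrow>\<^bsub>G\<^esub> w}"

definition closed_nbhd :: "('a, 'b) pre_digraph \<Rightarrow> 'a set \<Rightarrow> 'a set" where
  "closed_nbhd G A = A \<union> (\<Union>a\<in>A. nbhd G a)"

definition leaves :: "('a, 'b) pre_digraph \<Rightarrow> 'a set" where
  "leaves F = {v \<in> verts F. out_degree F v = 1}"

definition del_verts :: "('a, 'b) pre_digraph \<Rightarrow> 'a set \<Rightarrow> ('a, 'b) pre_digraph" where
  "del_verts F X = F \<restriction> (verts F - X)"

text \<open>
  The neighbourhoods are always those of \<open>T\<close>, only the leaves depend on the current
  forest \<open>F\<close>.
\<close>

definition leaf_nbrs ::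
  "('a, 'b) pre_digraph \<Rightarrow> 'a set \<Rightarrow> ('a, 'b) pre_digraph \<Rightarrow> 'a \<Rightarrow> 'a set" where
  "leaf_nbrs T A F v = (nbhd T v \<inter> leaves F) - A"

fun peel ::
  "('a, 'b) pre_digraph \<Rightarrow> 'a set \<Rightarrow> ('a, 'b) pre_digraph \<Rightarrow> 'a list \<Rightarrow> ('a, 'b) pre_digraph" where
  "peel T A F [] = F"
| "peel T A F (v # vs) = peel T A (del_verts F ({v} \<union> leaf_nbrs T A F v)) vs"

abbreviation reduction :: "('a, 'b) pre_digraph \<Rightarrow> 'a list \<Rightarrow> 'a set \<Rightarrow> ('a, 'b) pre_digraph" where
  "reduction T vs A \<equiv> peel T A T vs"

definition admissible :: "('a, 'b) pre_digraph \<Rightarrow> 'a set \<Rightarrow> nat \<Rightarrow> 'a list \<Rightarrow> bool" where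
  "admissible T A b vs \<longleftrightarrow> distinct vs \<and> set vs \<subseteq> verts T - A \<and>
     (\<forall>i < length vs. card (leaf_nbrs T A (reduction T (take i vs) A) (vs ! i)) = b)"

text \<open>
  The vertices of the sequence \<open>(v\<^sub>1, \<dots>, v\<^sub>t, u)\<close> are pairwise distinct,
  so \<open>u\<close> is none of the \<open>v\<^sub>i\<close>. This matters: a deleted \<open>v\<^sub>i\<close> may
  have many neighbours in \<open>T\<close> that are leaves of the remaining forest.
\<close>

definition problematic :: "('a, 'b) pre_digraph \<Rightarrow> 'a set \<Rightarrow> nat \<Rightarrow> 'a list \<Rightarrow> 'a \<Rightarrow> bool" where
  "problematic T A b vs u \<longleftrightarrow> admissible T A b vs \<and> u \<in> verts T - A \<and> u \<notin> set vs \<and>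
     card (leaf_nbrs T A (reduction T vs A) u) \<ge> b + 1"

definition good :: "('a, 'b) pre_digraph \<Rightarrow> 'a set \<Rightarrow> nat \<Rightarrow> bool" where
  "good T A b \<longleftrightarrow> \<not> (\<exists>vs u. problematic T A b vs u)"

text \<open>
  The \<open>(b:1)\<close> game with Staller moving first. Once a strategy \<open>\<sigma>\<close> of Dominator is
  fixed, a position is determined by the list of the vertices that Staller has claimed so far, in
  order. The set \<open>\<sigma> ss\<close> is what Dominator claims in answer to the last vertex of the
  nonempty list \<open>ss\<close>; the value of \<open>\<sigma>\<close> at the empty list is never used.
\<close>

type_synonym 'a strategy = "'a list \<Rightarrow> 'a set"

definition dom_claimed :: "'a strategy \<Rightarrow> 'a list \<Rightarrow> 'a set" where
  "dom_claimed \<sigma> ss = (\<Union>k\<in>{1..length ss}. \<sigma> (take k ss))"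

definition staller_play :: "('a, 'b) pre_digraph \<Rightarrow> 'a strategy \<Rightarrow> 'a list \<Rightarrow> bool" where
  "staller_play G \<sigma> ss \<longleftrightarrow>
     (\<forall>i < length ss. ss ! i \<in> verts G - (set (take i ss) \<union> dom_claimed \<sigma> (take i ss)))"

definition dominator_strategy :: "('a, 'b) pre_digraph \<Rightarrow> nat \<Rightarrow> 'a strategy \<Rightarrow> bool" where
  "dominator_strategy G b \<sigma> \<longleftrightarrow>
     (\<forall>ss. ss \<noteq> [] \<and> staller_play G \<sigma> ss \<longrightarrow>
        \<sigma> ss \<subseteq> verts G - (set ss \<union> dom_claimed \<sigma> (butlast ss)) \<and> card (\<sigma> ss) \<le> b)"

text \<open>The game ends when every vertex has been claimed.\<close>

definition finished :: "('a, 'b) pre_digraph \<Rightarrow> 'a strategy \<Rightarrow> 'a list \<Rightarrow> bool" where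
  "finished G \<sigma> ss \<longleftrightarrow> verts G \<subseteq> set ss \<union> dom_claimed \<sigma> ss"

definition dominated :: "('a, 'b) pre_digraph \<Rightarrow> 'a set \<Rightarrow> 'a \<Rightarrow> bool" where
  "dominated G D v \<longleftrightarrow> v \<in> D \<or> (\<exists>w \<in> nbhd G v. w \<in> D)"

definition dominator_wins_avoiding :: "('a, 'b) pre_digraph \<Rightarrow> 'a set \<Rightarrow> nat \<Rightarrow> bool" where
  "dominator_wins_avoiding G A b \<longleftrightarrow>
     (\<exists>\<sigma>. dominator_strategy G b \<sigma> \<and>
        (\<forall>ss. staller_play G \<sigma> ss \<longrightarrow> dom_claimed \<sigma> ss \<subseteq> verts G - A) \<and>
        (\<forall>ss. staller_play G \<sigma> ss \<and> finished G \<sigma> ss \<longrightarrow>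
           (\<forall>v \<in> verts G - closed_nbhd G A. dominated G (dom_claimed \<sigma> ss) v)))"

end

theory Submission
  imports Defs
begin

text \<open>
  Along a problematic sequence Staller's move at \<open>v\<^sub>i\<close> leaves every leaf it exposes without
  any other neighbour to dominate it, so Dominator has to claim all of these leaves at once, and
  the last move exposes one leaf too many. Conversely, Dominator wins as soon as there is a set
  \<open>M\<close> of edges of \<open>T - A\<close> in which every degree is at most \<open>b\<close> and every vertex
  outside \<open>N[A]\<close> has positive degree: he answers each vertex of Staller by its free
  \<open>M\<close>-neighbours. If \<open>T\<close> is good, such an \<open>M\<close> arises greedily as a union of stars: first
  from the vertices with exactly \<open>b\<close> leaves, which only continues an admissible sequence; once
  every vertex has fewer than \<open>b\<close> leaves, stars can be removed while each component keeps at
  most one vertex with \<open>b\<close> leaves.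
\<close>

section \<open>Stripping stars and edge covers in a finite forest\<close>

definition adj_on :: "('a \<Rightarrow> 'a set) \<Rightarrow> 'a set \<Rightarrow> ('a \<times> 'a) set" where
  "adj_on N H = {(x, y). x \<in> H \<and> y \<in> H \<and> y \<in> N x}"

lemma adj_on_mono: "H \<subseteq> K \<Longrightarrow> adj_on N H \<subseteq> adj_on N K"
  by (auto simp: adj_on_def)

text \<open>Induced subforests are represented by their vertex sets \<open>H\<close>. Acyclicity is
  encoded without walks: two distinct neighbours of \<open>v\<close> lie in different branches, so
  they are not connected once \<open>v\<close> is deleted.\<close>

locale finite_forest =
  fixes V :: "'a set" and N :: "'a \<Rightarrow> 'a set" and A :: "'a set" and b :: nat
  assumes finite_V: "finite V"
    and N_subset: "N x \<subseteq> V"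
    and N_sym: "y \<in> N x \<Longrightarrow> x \<in> N y"
    and N_irrefl: "x \<notin> N x"
    and N_acyclic: "x \<in> N v \<Longrightarrow> y \<in> N v \<Longrightarrow> x \<noteq> y \<Longrightarrow> (x, y) \<notin> (adj_on N (- {v}))\<^sup>*"
    and b_pos: "b \<ge> 1"
begin

definition leafs :: "'a set \<Rightarrow> 'a \<Rightarrow> 'a set" where
  "leafs H v = {w \<in> N v \<inter> H - A. card (N w \<inter> H) = 1}"

definition strip :: "'a set \<Rightarrow> 'a \<Rightarrow> 'a set" where
  "strip H v = H - insert v (leafs H v)"

definition edge_cover :: "'a set \<Rightarrow> ('a \<times> 'a) set \<Rightarrow> bool" where
  "edge_cover H M \<longleftrightarrow> M \<subseteq> adj_on N (H - A) \<and> sym M \<and> (\<forall>x. card (M `` {x}) \<le> b) \<and>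
     (\<forall>x \<in> H - A. M `` {x} \<noteq> {} \<or> N x \<inter> A \<noteq> {})"

lemma finite_N: "finite (N x)"
  using finite_V N_subset finite_subset by blast

lemma leafs_nbrs:
  assumes "w \<in> leafs H v" "v \<in> H"
  shows "N w \<inter> H = {v}"
proof -
  have "v \<in> N w \<inter> H" using assms N_sym by (auto simp: leafs_def)
  moreover obtain z where "N w \<inter> H = {z}"
    using assms(1) card_1_singletonE[of "N w \<inter> H"] by (auto simp: leafs_def)
  ultimately show ?thesis by auto
qed

lemma finite_leafs: "finite (leafs H v)"
  unfolding leafs_def using finite_N by (auto intro: finite_subset[OF _ finite_N])

lemma strip_subset: "strip H v \<subseteq> H"
  by (auto simp: strip_def)

lemma strip_psubset: "v \<in> H \<Longrightarrow> strip H v \<subset> H"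
  by (auto simp: strip_def)

text \<open>Stripped leaves have \<open>v\<close> as their only neighbour in \<open>H\<close>, so a
  surviving vertex can lose no neighbour but \<open>v\<close>. If that were its last one, it would
  be a leaf at \<open>v\<close> and would have been stripped too.\<close>

lemma strip_no_isolated:
  assumes iso: "\<And>x. x \<in> H - A \<Longrightarrow> N x \<inter> H \<noteq> {}" and v: "v \<in> H" and x: "x \<in> strip H v - A"
  shows "N x \<inter> strip H v \<noteq> {}"
proof
  assume e: "N x \<inter> strip H v = {}"
  have xH: "x \<in> H - A" "x \<noteq> v" "x \<notin> leafs H v" using x by (auto simp: strip_def)
  have "l \<notin> leafs H v" if "l \<in> N x" for l
    using leafs_nbrs[of l H v] v xH N_sym[OF that] by auto
  then have "N x \<inter> H \<subseteq> {v}" using e by (auto simp: strip_def)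
  then have "N x \<inter> H = {v}" using iso[OF xH(1)] by auto
  then have "x \<in> leafs H v" using xH N_sym[of v x] by (auto simp: leafs_def)
  then show False using xH by simp
qed

text \<open>For \<open>v \<notin> A\<close> the star from \<open>v\<close> to its leaves is added:
  it is disjoint from the old cover, gives \<open>v\<close> between 1 and \<open>b\<close> edges and
  each leaf one. For \<open>v \<in> A\<close> nothing is added, as the leaves are exempt through
  \<open>v\<close>.\<close>

lemma edge_cover_extend:
  assumes v: "v \<in> H" and M: "edge_cover (strip H v) M"
    and card: "v \<in> A \<or> card (leafs H v) \<le> b"
    and ne: "v \<in> A \<or> leafs H v \<noteq> {}"
  shows "\<exists>M. edge_cover H M"
proof (cases "v \<in> A")
  case True
  have "edge_cover H M"
    unfolding edge_cover_def
  proof (intro conjI ballI)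
    show "M \<subseteq> adj_on N (H - A)"
      using M adj_on_mono[of "strip H v - A" "H - A" N] strip_subset[of H v]
      unfolding edge_cover_def by blast
    show "sym M" "\<forall>x. card (M `` {x}) \<le> b" using M by (auto simp: edge_cover_def)
    fix x assume x: "x \<in> H - A"
    show "M `` {x} \<noteq> {} \<or> N x \<inter> A \<noteq> {}"
    proof (cases "x \<in> leafs H v")
      case True
      then show ?thesis using leafs_nbrs[of x H v] v \<open>v \<in> A\<close> by auto
    next
      case False
      then have "x \<in> strip H v - A" using x \<open>v \<in> A\<close> by (auto simp: strip_def)
      then show ?thesis using M by (auto simp: edge_cover_def)
    qed
  qed
  then show ?thesis ..
next
  case False
  define L where "L = leafs H v"
  have L: "L \<subseteq> N v \<inter> H - A" "card L \<le> b" "L \<noteq> {}" "v \<notin> L"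
    using card ne False N_irrefl by (auto simp: L_def leafs_def)
  define M' where "M' = M \<union> {v} \<times> L \<union> L \<times> {v}"
  have MH: "M \<subseteq> adj_on N (strip H v - A)" using M by (simp add: edge_cover_def)
  have notin: "(x, y) \<notin> M" "(y, x) \<notin> M" if "x \<in> insert v L" for x y
    using MH that by (auto simp: adj_on_def strip_def L_def)
  have Mv: "M' `` {v} = L" using notin L by (auto simp: M'_def)
  have Mleaf: "M' `` {x} = {v}" if "x \<in> L" for x using that notin L by (auto simp: M'_def)
  have Mo: "M' `` {x} = M `` {x}" if "x \<notin> insert v L" for x using that by (auto simp: M'_def)
  have "edge_cover H M'"
    unfolding edge_cover_def
  proof (intro conjI ballI allI)
    show "M' \<subseteq> adj_on N (H - A)"
    proof -
      have "M \<subseteq> adj_on N (H - A)"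
        using MH adj_on_mono[of "strip H v - A" "H - A" N] strip_subset[of H v] by blast
      moreover have "{v} \<times> L \<subseteq> adj_on N (H - A)" using L v False by (auto simp: adj_on_def)
      moreover have "L \<times> {v} \<subseteq> adj_on N (H - A)"
        using L v False N_sym by (auto simp: adj_on_def)
      ultimately show ?thesis by (simp add: M'_def)
    qed
    show "sym M'" using M by (auto simp: edge_cover_def M'_def sym_def)
    show "card (M' `` {x}) \<le> b" for x
      using Mv Mleaf[of x] Mo[of x] L(2) b_pos M by (cases "x \<in> insert v L") (auto simp: edge_cover_def)
    fix x assume x: "x \<in> H - A"
    show "M' `` {x} \<noteq> {} \<or> N x \<inter> A \<noteq> {}"
    proof (cases "x \<in> insert v L")
      case True
      then show ?thesis using Mv Mleaf[of x] L by auto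
    next
      case False
      then have "x \<in> strip H v - A" using x by (auto simp: strip_def L_def)
      then show ?thesis using M Mo[OF False] by (auto simp: edge_cover_def)
    qed
  qed
  then show ?thesis ..
qed

section \<open>Components, low degrees and vertices with \<open>b\<close> leaves\<close>

lemma sym_adj_on: "sym (adj_on N H)"
  using N_sym by (auto simp: adj_on_def sym_def)

lemma adj_on_rtrancl_in: "(x, y) \<in> (adj_on N H)\<^sup>* \<Longrightarrow> x \<in> H \<Longrightarrow> y \<in> H"
  by (induction rule: rtrancl_induct) (auto simp: adj_on_def)

lemma adj_on_rtrancl_mono: "(x, y) \<in> (adj_on N H)\<^sup>* \<Longrightarrow> H \<subseteq> K \<Longrightarrow> (x, y) \<in> (adj_on N K)\<^sup>*"
  using rtrancl_mono[OF adj_on_mono] by blast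

text \<open>
  If every degree were at least two, crossing the edge \<open>v x\<close> to a further neighbour \<open>y\<close> of
  \<open>x\<close> would strictly shrink the branch behind the edge for ever.
\<close>
lemma ex_degree_le_1:
  assumes "H \<subseteq> V" "H \<noteq> {}"
  shows "\<exists>v \<in> H. card (N v \<inter> H) \<le> 1"
proof (rule ccontr)
  assume "\<not> ?thesis"
  then have deg: "card (N v \<inter> H) \<ge> 2" if "v \<in> H" for v using that by force
  have other: "\<exists>y \<in> N v \<inter> H. y \<noteq> x" if "v \<in> H" for v x
  proof (rule ccontr)
    assume "\<not> ?thesis"
    then have "N v \<inter> H \<subseteq> {x}" by auto
    then have "card (N v \<inter> H) \<le> card {x}" by (intro card_mono) auto
    then show False using deg[OF that] by simp
  qed
  define R where "R v x = {y. (x, y) \<in> (adj_on N (H - {v}))\<^sup>*}" for v x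
  have False if "v \<in> H" "x \<in> N v \<inter> H" for v x
    using that
  proof (induction "card (R v x)" arbitrary: v x rule: less_induct)
    case less
    have xv: "x \<noteq> v" using less N_irrefl by auto
    from other[of x v] less obtain y where y: "y \<in> N x" "y \<in> H" "y \<noteq> v" by auto
    have sub: "R x y \<subseteq> R v x - {x}"
    proof
      fix z assume "z \<in> R x y"
      then have "(y, z) \<in> (adj_on N (H - {x}))\<^sup>*" by (simp add: R_def)
      then have "(x, z) \<in> (adj_on N (H - {v}))\<^sup>* \<and> z \<noteq> x"
      proof (induction rule: rtrancl_induct)
        case base
        have "(x, y) \<in> adj_on N (H - {v})" using y less xv by (auto simp: adj_on_def)
        then show ?case using y N_irrefl by auto
      next
        case (step z w)
        have "(y, w) \<in> (adj_on N (H - {x}))\<^sup>*" using step by auto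
        then have "(y, w) \<in> (adj_on N (- {x}))\<^sup>*" by (rule adj_on_rtrancl_mono) auto
        \<comment> \<open>Reaching \<open>v\<close> would connect \<open>y\<close> and
          \<open>v\<close>, two distinct neighbours of \<open>x\<close>, without passing through
          \<open>x\<close>.\<close>
        then have w: "w \<noteq> v" using N_acyclic[of y x v] y less N_sym by blast
        have "(y, z) \<in> (adj_on N (- {x}))\<^sup>*" using step(1) by (rule adj_on_rtrancl_mono) auto
        then have z: "z \<noteq> v" using N_acyclic[of y x v] y less N_sym by blast
        have "(z, w) \<in> adj_on N (H - {v})" "w \<noteq> x" using step(2) w z by (auto simp: adj_on_def)
        then show ?case using step by auto
      qed
      then show "z \<in> R v x - {x}" by (simp add: R_def)
    qed
    have "x \<in> R v x" by (simp add: R_def)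
    moreover have "R v x \<subseteq> H"
      using adj_on_rtrancl_in[of x _ "H - {v}"] less xv by (auto simp: R_def)
    then have "finite (R v x)"
      using finite_subset[OF _ finite_V, of "R v x"] assms(1) by (meson order_trans)
    ultimately have "card (R x y) < card (R v x)"
      using sub by (intro psubset_card_mono) auto
    then show False using less y by blast
  qed
  then show False using other assms by blast
qed

text \<open>
  Deleting \<open>v\<close> turns at most one neighbour in each branch at \<open>v\<close> into a leaf, so a branch
  acquires at most one vertex with \<open>b\<close> leaves.
\<close>
lemma leafs_strip:
  assumes v: "v \<in> H" and s: "s \<in> strip H v"
  obtains "leafs (strip H v) s \<subseteq> leafs H s"
  | x where "x \<in> N v" "x \<in> N s" "x \<in> strip H v" "N x \<inter> strip H v = {s}"
      "leafs (strip H v) s \<subseteq> insert x (leafs H s)"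
proof -
  let ?K = "strip H v"
  have new: "w \<in> N v \<and> w \<in> N s \<and> w \<in> ?K \<and> N w \<inter> ?K = {s}"
    if w: "w \<in> leafs ?K s" "w \<notin> leafs H s" for w
  proof -
    have wK: "w \<in> N s" "w \<in> ?K" "w \<notin> A" "N w \<inter> ?K = {s}"
      using w leafs_nbrs[OF w(1) s] by (auto simp: leafs_def)
    have "l \<notin> leafs H v" if "l \<in> N w" for l
      using leafs_nbrs[of l H v] v wK N_sym[OF that] by (auto simp: strip_def)
    then have sub: "N w \<inter> H \<subseteq> {v, s}" using wK by (auto simp: strip_def)
    have "v \<in> N w"
    proof (rule ccontr)
      assume "v \<notin> N w"
      then have "N w \<inter> H = {s}" using sub s wK N_sym by (auto simp: strip_def)
      then show False using w wK by (auto simp: leafs_def strip_def)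
    qed
    then show ?thesis using wK N_sym by auto
  qed
  show thesis
  proof (cases "leafs ?K s \<subseteq> leafs H s")
    case True
    then show thesis using that(1) by blast
  next
    case False
    then obtain x where x: "x \<in> leafs ?K s" "x \<notin> leafs H s" by blast
    have "leafs ?K s \<subseteq> insert x (leafs H s)"
    proof
      fix y assume y: "y \<in> leafs ?K s"
      show "y \<in> insert x (leafs H s)"
      proof (rule ccontr)
        assume "\<not> ?thesis"
        then have ny: "y \<notin> leafs H s" "x \<noteq> y" by auto
        \<comment> \<open>Two new leaves would both be neighbours of \<open>v\<close>, and they are
          joined through \<open>s\<close> without using \<open>v\<close>.\<close>
        have "s \<noteq> v" using s by (auto simp: strip_def)
        moreover have "x \<noteq> v" "y \<noteq> v" using new[OF x] new[OF y ny(1)] N_irrefl by auto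
        ultimately have "(x, s) \<in> adj_on N (- {v})" "(s, y) \<in> adj_on N (- {v})"
          using new[OF x] new[OF y ny(1)] N_sym by (auto simp: adj_on_def)
        then have "(x, y) \<in> (adj_on N (- {v}))\<^sup>*" by auto
        then show False using N_acyclic[of x v y] new[OF x] new[OF y ny(1)] ny by auto
      qed
    qed
    then show thesis using that(2) new[OF x] by blast
  qed
qed

text \<open>Call a vertex with \<open>b\<close> leaves full. The last hypothesis, at most one full
  vertex per component, is the invariant that survives stripping a suitable \<open>v\<close>.
  Induction on \<open>card H\<close> then yields a cover of the rest, which the star at
  \<open>v\<close> extends.\<close>

lemma edge_cover_few_leafs:
  assumes "H \<subseteq> V"
    and "\<And>x. x \<in> H - A \<Longrightarrow> N x \<inter> H \<noteq> {}"
    and "\<And>x. x \<in> H - A \<Longrightarrow> card (leafs H x) \<le> b"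
    and "\<And>s s'. s \<in> H - A \<Longrightarrow> s' \<in> H - A \<Longrightarrow> card (leafs H s) = b \<Longrightarrow> card (leafs H s') = b
      \<Longrightarrow> s \<noteq> s' \<Longrightarrow> (s, s') \<notin> (adj_on N H)\<^sup>*"
  shows "\<exists>M. edge_cover H M"
  using assms
proof (induction "card H" arbitrary: H rule: less_induct)
  case less
  note HV = less.prems(1) and iso = less.prems(2) and le = less.prems(3) and spec = less.prems(4)
  show ?case
  proof (cases "H = {}")
    case True
    have "edge_cover {} {}" by (auto simp: edge_cover_def sym_def)
    then show ?thesis using True by blast
  next
    case False
    \<comment> \<open>Choice of \<open>v\<close>: a full vertex if there is one, otherwise a vertex
      of \<open>A\<close>, otherwise the neighbour of a leaf. So if any full vertex exists,
      \<open>v\<close> is full itself.\<close>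
    have "\<exists>v \<in> H. (v \<in> A \<or> leafs H v \<noteq> {}) \<and>
      ((\<exists>s \<in> H - A. card (leafs H s) = b) \<longrightarrow> v \<notin> A \<and> card (leafs H v) = b)"
    proof (cases "\<exists>s \<in> H - A. card (leafs H s) = b")
      case True
      then obtain s where "s \<in> H - A" "card (leafs H s) = b" by blast
      moreover then have "leafs H s \<noteq> {}" using b_pos by auto
      ultimately show ?thesis by blast
    next
      case no: False
      show ?thesis
      proof (cases "H \<inter> A = {}")
        case True
        obtain w where w: "w \<in> H" "card (N w \<inter> H) \<le> 1"
          using ex_degree_le_1[OF HV False] by blast
        have ne: "N w \<inter> H \<noteq> {}" using iso w True by auto
        then obtain v where v: "v \<in> N w" "v \<in> H" by blast
        have "card (N w \<inter> H) \<noteq> 0" using ne finite_N by auto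
        then have "w \<in> leafs H v" using w v N_sym True by (auto simp: leafs_def)
        then show ?thesis using v no by blast
      next
        case False
        then show ?thesis using no by blast
      qed
    qed
    then obtain v where v: "v \<in> H" "v \<in> A \<or> leafs H v \<noteq> {}"
      and vs: "\<And>s. s \<in> H - A \<Longrightarrow> card (leafs H s) = b \<Longrightarrow> v \<notin> A \<and> card (leafs H v) = b"
      by blast
    let ?K = "strip H v"
    have fH: "finite H" using HV finite_V finite_subset by blast
    have KH: "?K \<subseteq> H" by (rule strip_subset)
    have vK: "?K \<subseteq> - {v}" by (auto simp: strip_def)
    \<comment> \<open>Another full vertex forces \<open>v\<close> to be full, hence to lie in a
      different component.\<close>
    have unreach: "(s, v) \<notin> (adj_on N H)\<^sup>*" if "s \<in> ?K - A" "card (leafs H s) = b" for s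
      using spec[of s v] vs[of s] that KH vK v by auto
    \<comment> \<open>A vertex gaining a leaf is connected to \<open>v\<close> through that leaf, so
      it was not full before and the gain of one keeps it within \<open>b\<close>.\<close>
    have grow: "card (leafs ?K s) \<le> card (leafs H s) \<or>
        (\<exists>x. x \<in> N v \<and> x \<in> N s \<and> x \<in> ?K \<and> N x \<inter> ?K = {s} \<and>
           card (leafs ?K s) \<le> Suc (card (leafs H s)) \<and> card (leafs H s) < b)"
      if s: "s \<in> ?K - A" for s
    proof -
      have "s \<in> ?K" using s by simp
      from v(1) this show ?thesis
      proof (cases rule: leafs_strip)
        case 1
        then show ?thesis using card_mono finite_leafs by blast
      next
        case (2 x)
        have "card (leafs ?K s) \<le> card (insert x (leafs H s))"
          using 2 finite_leafs by (intro card_mono) auto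
        also have "\<dots> \<le> Suc (card (leafs H s))" using finite_leafs by (simp add: card_insert_if)
        finally have c: "card (leafs ?K s) \<le> Suc (card (leafs H s))" .
        have "(s, x) \<in> adj_on N H" "(x, v) \<in> adj_on N H"
          using 2 s KH v N_sym by (auto simp: adj_on_def)
        then have "(s, v) \<in> (adj_on N H)\<^sup>*" by auto
        then have "card (leafs H s) \<noteq> b" using unreach s by blast
        moreover have "card (leafs H s) \<le> b" using le s KH by auto
        ultimately show ?thesis using 2 c by auto
      qed
    qed
    have "\<exists>M. edge_cover ?K M"
    proof (rule less.hyps)
      show "card ?K < card H" using strip_psubset[OF v(1)] fH by (rule psubset_card_mono[rotated])
      show "?K \<subseteq> V" using KH HV by blast
      show "N x \<inter> ?K \<noteq> {}" if "x \<in> ?K - A" for x using strip_no_isolated[OF iso v(1) that] by blast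
      show "card (leafs ?K x) \<le> b" if "x \<in> ?K - A" for x
        using grow[OF that] le[of x] that KH by auto
      fix s s' assume s: "s \<in> ?K - A" "s' \<in> ?K - A" "card (leafs ?K s) = b" "card (leafs ?K s') = b"
        "s \<noteq> s'"
      show "(s, s') \<notin> (adj_on N ?K)\<^sup>*"
      proof
        assume r: "(s, s') \<in> (adj_on N ?K)\<^sup>*"
        have r': "(s', s) \<in> (adj_on N ?K)\<^sup>*"
          using r sym_rtrancl[OF sym_adj_on] by (meson symD)
        have rH: "(s, s') \<in> (adj_on N H)\<^sup>*" "(s', s) \<in> (adj_on N H)\<^sup>*"
          using adj_on_rtrancl_mono[OF r KH] adj_on_rtrancl_mono[OF r' KH] by auto
        have reach: "(t, v) \<in> (adj_on N H)\<^sup>*" if "x \<in> N v" "x \<in> N t" "x \<in> ?K" "t \<in> ?K" for t x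
        proof -
          have "(t, x) \<in> adj_on N H" "(x, v) \<in> adj_on N H"
            using that KH v N_sym by (auto simp: adj_on_def)
          then show ?thesis by auto
        qed
        have old: "card (leafs H s) = b" if "\<not> (\<exists>x. x \<in> N v \<and> x \<in> N s \<and> x \<in> ?K \<and> N x \<inter> ?K = {s})"
          using grow[OF s(1)] that s le[of s] KH by auto
        have old': "card (leafs H s') = b"
          if "\<not> (\<exists>x. x \<in> N v \<and> x \<in> N s' \<and> x \<in> ?K \<and> N x \<inter> ?K = {s'})"
          using grow[OF s(2)] that s le[of s'] KH by auto
        \<comment> \<open>A full vertex of the stripped forest was either full in \<open>H\<close>
          or became so by gaining a leaf adjacent to \<open>v\<close>. Each combination for the pair
          \<open>s\<close>, \<open>s'\<close> is impossible if they are connected.\<close>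
        consider (a) "card (leafs H s) = b" | (b) "card (leafs H s') = b"
          | (c) "card (leafs H s) \<noteq> b" "card (leafs H s') \<noteq> b" by blast
        then show False
        proof cases
          case a
          have "card (leafs H s') \<noteq> b" using spec[of s s'] a s rH KH by auto
          then obtain x where "x \<in> N v" "x \<in> N s'" "x \<in> ?K" using old' by blast
          \<comment> \<open>The newly full \<open>s'\<close> reaches \<open>v\<close>, and so does
            the old full \<open>s\<close> through \<open>s'\<close>, against
            \<open>unreach\<close>.\<close>
          then have "(s', v) \<in> (adj_on N H)\<^sup>*" using reach s by auto
          then show False using rH unreach[OF s(1) a] rtrancl_trans by metis
        next
          case b
          have "card (leafs H s) \<noteq> b" using spec[of s s'] b s rH KH by auto
          then obtain x where "x \<in> N v" "x \<in> N s" "x \<in> ?K" using old by blast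
          then have "(s, v) \<in> (adj_on N H)\<^sup>*" using reach s by auto
          then show False using rH unreach[OF s(2) b] rtrancl_trans by metis
        next
          case c
          from old c obtain x where x: "x \<in> N v" "x \<in> N s" "x \<in> ?K" "N x \<inter> ?K = {s}" by blast
          from old' c obtain y where y: "y \<in> N v" "y \<in> N s'" "y \<in> ?K" "N y \<inter> ?K = {s'}" by blast
          \<comment> \<open>Both are newly full: their new leaves \<open>x\<close>, \<open>y\<close>
            are distinct neighbours of \<open>v\<close> joined by a path avoiding \<open>v\<close>,
            which closes a cycle.\<close>
          have "x \<noteq> y" using x y s by auto
          moreover have "(x, s) \<in> adj_on N ?K" "(s', y) \<in> adj_on N ?K"
            using x y s N_sym by (auto simp: adj_on_def)
          then have "(x, y) \<in> (adj_on N ?K)\<^sup>*" using r by (meson rtrancl.simps converse_rtrancl_into_rtrancl)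
          then have "(x, y) \<in> (adj_on N (- {v}))\<^sup>*" by (rule adj_on_rtrancl_mono[OF _ vK])
          ultimately show False using N_acyclic x y by blast
        qed
      qed
    qed
    then obtain M where M: "edge_cover ?K M" by blast
    have "v \<in> A \<or> card (leafs H v) \<le> b" using le v by auto
    then show ?thesis using edge_cover_extend[OF v(1) M] v(2) by blast
  qed
qed

end

section \<open>Induced subgraphs, degrees and cycles in digraphs\<close>

lemma arcs_ends_induce: "arcs_ends (T \<restriction> H) = {(x, y) \<in> arcs_ends T. x \<in> H \<and> y \<in> H}"
  by (auto simp: arcs_ends_conv induce_subgraph_def)

lemma restrict_verts: "wf_digraph T \<Longrightarrow> T \<restriction> verts T = T"
  by (auto simp: induce_subgraph_def wf_digraph_def intro!: pre_digraph.equality)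

lemma del_verts_restrict: "del_verts (T \<restriction> H) X = T \<restriction> (H - X)"
  by (auto simp: del_verts_def induce_subgraph_def intro!: pre_digraph.equality)

text \<open>Without parallel arcs an outgoing arc is determined by its head, so degrees can be
  counted by neighbours.\<close>

lemma out_degree_restrict:
  assumes "nomulti_digraph T" "v \<in> H"
  shows "out_degree (T \<restriction> H) v = card (nbhd T v \<inter> H)"
proof -
  interpret nomulti_digraph T by fact
  have "inj_on (head T) (out_arcs (T \<restriction> H) v)"
    by (rule inj_onI) (auto simp: out_arcs_def induce_subgraph_def arc_to_ends_def intro: no_multi_arcs)
  moreover have "head T ` out_arcs (T \<restriction> H) v = nbhd T v \<inter> H"
    using assms(2) by (auto simp: out_arcs_def induce_subgraph_def nbhd_def arcs_ends_conv)
  ultimately show ?thesis unfolding out_degree_def using card_image by metis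
qed

text \<open>Supplies \<open>N_acyclic\<close> for trees: a simple path from \<open>x\<close> to
  \<open>y\<close> in the graph without \<open>v\<close> closes up with the arcs \<open>v\<close> to
  \<open>x\<close> and \<open>y\<close> to \<open>v\<close>. The path has at least one arc since
  \<open>x \<noteq> y\<close>, whence the length at least three.\<close>

lemma (in wf_digraph) nbhd_avoiding_path_cycle:
  assumes x: "x \<in> nbhd G v" and y: "v \<in> nbhd G y" and ne: "x \<noteq> y"
    and path: "(x, y) \<in> (adj_on (nbhd G) (- {v}))\<^sup>*" and loop: "v \<notin> nbhd G v"
  shows "\<exists>p. cycle p \<and> 3 \<le> length p"
proof -
  let ?H = "G \<restriction> (verts G - {v})"
  have xV: "x \<in> verts G - {v}" using x loop by (auto simp: nbhd_def dest: adj_in_verts)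
  interpret H: wf_digraph ?H by (rule wellformed_induce_subgraph)
  have "adj_on (nbhd G) (- {v}) \<subseteq> arcs_ends ?H"
    by (auto simp: adj_on_def arcs_ends_induce nbhd_def dest: adj_in_verts)
  then have "(x, y) \<in> (arcs_ends ?H)\<^sup>*" using path rtrancl_mono by blast
  then have "x \<rightarrow>\<^sup>*\<^bsub>?H\<^esub> y" using xV by (subst H.reachable_conv') auto
  then obtain p where p: "H.apath x p y" using H.reachable_apath by blast
  have sub: "subgraph ?H G" by (rule induced_imp_subgraph[OF induced_induce]) auto
  have "set (H.awalk_verts x p) \<subseteq> verts ?H"
    using p unfolding H.apath_def H.awalk_conv by blast
  then have v: "v \<notin> set (awalk_verts x p)"
    using compatible_awalk_verts[of G ?H] sub by (auto simp: subgraph_def)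
  have pG: "apath x p y" using subgraph_apath_imp_apath[OF p sub] .
  obtain e1 where e1: "e1 \<in> arcs G" "tail G e1 = v" "head G e1 = x" using x by (auto simp: nbhd_def)
  obtain e2 where e2: "e2 \<in> arcs G" "tail G e2 = y" "head G e2 = v" using y by (auto simp: nbhd_def)
  have "p \<noteq> []" using pG ne by (auto simp: apath_def awalk_def)
  have "awalk y [e2] v" using e2 by (auto simp: awalk_def)
  with pG have aw: "awalk x (p @ [e2]) v" by (auto simp: apath_def)
  then have "awalk v (e1 # p @ [e2]) v" using e1 by (auto simp: awalk_Cons_iff)
  moreover have "awalk_verts x (p @ [e2]) = awalk_verts x p @ [v]"
  proof -
    have "awlast x p = y" using pG unfolding apath_def awalk_conv by blast
    then show ?thesis using awalk_verts_append[OF aw] e2 by simp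
  qed
  then have "distinct (tl (awalk_verts v (e1 # p @ [e2])))"
    using e1 pG v by (auto simp: apath_def)
  ultimately have "cycle (e1 # p @ [e2])" by (auto simp: cycle_def)
  moreover have "3 \<le> length (e1 # p @ [e2])" using \<open>p \<noteq> []\<close> by (cases p) auto
  ultimately show ?thesis by blast
qed

section \<open>Plays of the game and their continuation\<close>

lemma dom_claimed_snoc: "dom_claimed \<sigma> (ss @ [x]) = dom_claimed \<sigma> ss \<union> \<sigma> (ss @ [x])"
proof -
  have "{1..Suc (length ss)} = insert (Suc (length ss)) {1..length ss}" by auto
  then show ?thesis by (auto simp: dom_claimed_def)
qed

lemma dom_claimed_Nil [simp]: "dom_claimed \<sigma> [] = {}"
  by (simp add: dom_claimed_def)

lemma staller_play_Nil [simp]: "staller_play G \<sigma> []"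
  by (simp add: staller_play_def)

lemma staller_play_snoc:
  "staller_play G \<sigma> (ss @ [x]) \<longleftrightarrow>
     staller_play G \<sigma> ss \<and> x \<in> verts G - (set ss \<union> dom_claimed \<sigma> ss)"
  by (auto simp: staller_play_def nth_append less_Suc_eq)

lemma staller_play_disjoint:
  assumes "dominator_strategy G b \<sigma>" "staller_play G \<sigma> ss"
  shows "set ss \<inter> dom_claimed \<sigma> ss = {}"
  using assms(2)
proof (induction ss rule: rev_induct)
  case (snoc x ss)
  have "\<sigma> (ss @ [x]) \<inter> set (ss @ [x]) = {}"
    using assms(1) snoc.prems unfolding dominator_strategy_def by blast
  then show ?case using snoc by (auto simp: staller_play_snoc dom_claimed_snoc)
qed simp

text \<open>Winning is stated for finished plays only, so a line of play that is bad for Dominator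
  has to be continued to the end. Each further move of Staller shrinks the set of vertices he has
  not claimed.\<close>

lemma staller_play_extend:
  assumes "finite (verts G)" "staller_play G \<sigma> ss"
  shows "\<exists>ts. staller_play G \<sigma> (ss @ ts) \<and> finished G \<sigma> (ss @ ts)"
  using assms(2)
proof (induction "card (verts G - set ss)" arbitrary: ss rule: less_induct)
  case less
  show ?case
  proof (cases "finished G \<sigma> ss")
    case True
    then show ?thesis using less by (intro exI[of _ "[]"]) simp
  next
    case False
    then obtain x where x: "x \<in> verts G - (set ss \<union> dom_claimed \<sigma> ss)"
      by (auto simp: finished_def)
    then have "card (verts G - set (ss @ [x])) < card (verts G - set ss)"
      using assms(1) by (intro psubset_card_mono) auto
    from less.hyps[OF this] less.prems x
    obtain ts where "staller_play G \<sigma> ((ss @ [x]) @ ts) \<and> finished G \<sigma> ((ss @ [x]) @ ts)"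
      by (auto simp: staller_play_snoc)
    then show ?thesis by (intro exI[of _ "x # ts"]) simp
  qed
qed

section \<open>The tree as a finite forest\<close>

locale avoiding_game =
  fixes T :: "('a, 'b) pre_digraph" and A :: "'a set" and b :: nat
  assumes b_pos: "b \<ge> 1" and tree_T: "is_tree T"
    and card_T: "card (verts T) \<ge> 2"
begin

sublocale graph T
  using tree_T by (simp add: is_tree_def)

lemma nbhd_sym: "y \<in> nbhd T x \<Longrightarrow> x \<in> nbhd T y"
  using arcs_ends_symmetric[OF sym_arcs] by (simp add: nbhd_def)

lemma nbhd_irrefl: "x \<notin> nbhd T x"
  using adj_not_same by (auto simp: nbhd_def)

sublocale finite_forest "verts T" "nbhd T" A b
proof
  show "finite (verts T)" by simp
  show "nbhd T x \<subseteq> verts T" for x by (auto simp: nbhd_def dest: adj_in_verts)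
  show "y \<in> nbhd T x \<Longrightarrow> x \<in> nbhd T y" for x y by (rule nbhd_sym)
  show "x \<notin> nbhd T x" for x by (rule nbhd_irrefl)
  show "b \<ge> 1" by (rule b_pos)
  show "(x, y) \<notin> (adj_on (nbhd T) (- {v}))\<^sup>*"
    if "x \<in> nbhd T v" "y \<in> nbhd T v" "x \<noteq> y" for x y v
    using nbhd_avoiding_path_cycle[OF that(1) nbhd_sym[OF that(2)] that(3) _ nbhd_irrefl] tree_T
    unfolding is_tree_def by blast
qed

lemma nbhd_nonempty:
  assumes "x \<in> verts T"
  shows "nbhd T x \<noteq> {}"
proof -
  have "verts T - {x} \<noteq> {}"
  proof
    assume "verts T - {x} = {}"
    then have "verts T \<subseteq> {x}" by auto
    then have "card (verts T) \<le> card {x}" by (intro card_mono) auto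
    then show False using card_T by simp
  qed
  then obtain y where y: "y \<in> verts T" "y \<noteq> x" by auto
  have "x \<rightarrow>\<^sup>*\<^bsub>mk_symmetric T\<^esub> y"
    using tree_T assms y(1) by (auto simp: is_tree_def connected_def strongly_connected_def)
  then have "x \<rightarrow>\<^sup>*\<^bsub>T\<^esub> y" using reachable_mk_symmetric_eq[OF sym_arcs] by simp
  then show ?thesis using y by (cases rule: pre_digraph.converse_reachable_cases) (auto simp: nbhd_def)
qed

section \<open>Admissible sequences as repeated stripping\<close>

definition rest :: "'a list \<Rightarrow> 'a set" where
  "rest vs = foldl strip (verts T) vs"

lemma rest_Nil [simp]: "rest [] = verts T"
  by (simp add: rest_def)

lemma rest_snoc [simp]: "rest (vs @ [v]) = strip (rest vs) v"
  by (simp add: rest_def)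

lemma rest_subset: "rest vs \<subseteq> verts T"
  by (induction vs rule: rev_induct) (use strip_subset in auto)

lemma rest_disjoint: "set vs \<inter> rest vs = {}"
  by (induction vs rule: rev_induct) (auto simp: strip_def)

lemma leaf_nbrs_restrict: "leaf_nbrs T A (T \<restriction> H) v = leafs H v"
  by (auto simp: leaf_nbrs_def leafs_def leaves_def out_degree_restrict[OF nomulti_digraph])

text \<open>The starting set \<open>H\<close> is arbitrary because \<open>peel\<close> recurses on
  the front of the list. Afterwards sequences are extended at the end, which suits both
  admissibility and plays.\<close>

lemma peel_restrict: "peel T A (T \<restriction> H) vs = T \<restriction> foldl strip H vs"
  by (induction vs arbitrary: H)
    (simp_all add: del_verts_restrict leaf_nbrs_restrict strip_def)

lemma reduction_rest: "reduction T vs A = T \<restriction> rest vs"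
  using peel_restrict[of "verts T" vs] restrict_verts[OF wf_digraph] by (simp add: rest_def)

lemma admissible_Nil: "admissible T A b []"
  by (simp add: admissible_def)

lemma admissible_snoc:
  "admissible T A b (vs @ [v]) \<longleftrightarrow>
     admissible T A b vs \<and> v \<in> verts T - A - set vs \<and> card (leafs (rest vs) v) = b"
  by (auto simp: admissible_def reduction_rest leaf_nbrs_restrict nth_append less_Suc_eq)

lemma problematic_rest:
  "problematic T A b vs u \<longleftrightarrow>
     admissible T A b vs \<and> u \<in> verts T - A - set vs \<and> card (leafs (rest vs) u) \<ge> b + 1"
  by (auto simp: problematic_def reduction_rest leaf_nbrs_restrict)

section \<open>From goodness to a winning strategy\<close>

text \<open>Stripping a vertex with exactly \<open>b\<close> leaves extends the admissible sequence,
  so goodness keeps bounding all leaf counts by \<open>b\<close>. The process ends when no vertex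
  outside \<open>A\<close> has \<open>b\<close> leaves.\<close>

lemma edge_cover_rest:
  assumes good: "good T A b" and "admissible T A b vs"
    and "\<And>x. x \<in> rest vs - A \<Longrightarrow> nbhd T x \<inter> rest vs \<noteq> {}"
  shows "\<exists>M. edge_cover (rest vs) M"
  using assms(2,3)
proof (induction "card (rest vs)" arbitrary: vs rule: less_induct)
  case less
  have le: "card (leafs (rest vs) x) \<le> b" if "x \<in> rest vs - A" for x
  proof (rule ccontr)
    assume "\<not> ?thesis"
    then have "problematic T A b vs x"
      using that less.prems(1) rest_subset rest_disjoint by (fastforce simp: problematic_rest)
    then show False using good by (auto simp: good_def)
  qed
  show ?case
  proof (cases "\<exists>v \<in> rest vs - A. card (leafs (rest vs) v) = b")
    case True
    then obtain v where v: "v \<in> rest vs - A" "card (leafs (rest vs) v) = b" by blast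
    have fin: "finite (rest vs)" using finite_subset[OF rest_subset] by simp
    have vr: "v \<in> rest vs" using v by simp
    have "\<exists>M. edge_cover (rest (vs @ [v])) M"
    proof (rule less.hyps)
      show "card (rest (vs @ [v])) < card (rest vs)"
        using strip_psubset[OF vr] fin by (simp add: psubset_card_mono)
      show "admissible T A b (vs @ [v])"
        using v less.prems(1) rest_subset[of vs] rest_disjoint[of vs] by (auto simp: admissible_snoc)
      show "nbhd T x \<inter> rest (vs @ [v]) \<noteq> {}" if "x \<in> rest (vs @ [v]) - A" for x
        using strip_no_isolated[OF less.prems(2) vr] that by simp
    qed
    then obtain M where M: "edge_cover (strip (rest vs) v) M" by auto
    have "leafs (rest vs) v \<noteq> {}" using v b_pos by auto
    then show ?thesis using edge_cover_extend[OF vr M] v by simp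
  next
    case False
    \<comment> \<open>With no full vertex left, the separation hypothesis of
      \<open>edge_cover_few_leafs\<close> holds vacuously.\<close>
    then show ?thesis
      using edge_cover_few_leafs[OF rest_subset less.prems(2) le] by blast
  qed
qed

lemma good_imp_edge_cover:
  assumes "good T A b"
  shows "\<exists>M. edge_cover (verts T) M"
proof -
  have "nbhd T x \<inter> verts T \<noteq> {}" if "x \<in> verts T" for x
    using nbhd_nonempty[OF that] N_subset by blast
  then show ?thesis using edge_cover_rest[OF assms admissible_Nil] by simp
qed

text \<open>
  The invariant of the play: every \<open>M\<close>-neighbour of a vertex claimed by Staller is claimed
  by Dominator. So the vertices Dominator has claimed before can be excluded from an answer without
  defining the strategy recursively.
\<close>
lemma edge_cover_imp_wins:
  assumes M: "edge_cover (verts T) M"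
  shows "dominator_wins_avoiding T A b"
proof -
  have MT: "M \<subseteq> adj_on (nbhd T) (verts T - A)" and "sym M"
    and deg: "card (M `` {x}) \<le> b"
    and cov: "x \<in> verts T - A \<Longrightarrow> M `` {x} \<noteq> {} \<or> nbhd T x \<inter> A \<noteq> {}" for x
    using M by (auto simp: edge_cover_def)
  have Msym: "(y, x) \<in> M" if "(x, y) \<in> M" for x y using that \<open>sym M\<close> by (rule symD[rotated])
  have Mirr: "(x, x) \<notin> M" for x using MT nbhd_irrefl by (auto simp: adj_on_def)
  have MV: "y \<in> verts T - A" if "(x, y) \<in> M" for x y using MT that by (auto simp: adj_on_def)
  have finM: "finite (M `` {x})" for x
    by (rule finite_subset[of _ "verts T"]) (use MV in auto)
  define \<sigma> where "\<sigma> ss = (if ss = [] then {} else M `` {last ss} - set ss - M `` set (butlast ss))" for ss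
  have \<sigma>_snoc: "\<sigma> (ss @ [x]) = M `` {x} - set (ss @ [x]) - M `` set ss" for ss x
    by (simp add: \<sigma>_def)
  have dom: "dom_claimed \<sigma> ss \<subseteq> M `` set ss" for ss
    by (induction ss rule: rev_induct) (auto simp: dom_claimed_snoc \<sigma>_snoc)
  have inv: "M `` set ss \<subseteq> dom_claimed \<sigma> ss" if "staller_play T \<sigma> ss" for ss
    using that
  proof (induction ss rule: rev_induct)
    case (snoc x ss)
    have IH: "M `` set ss \<subseteq> dom_claimed \<sigma> ss" and x: "x \<notin> set ss" "x \<notin> dom_claimed \<sigma> ss"
      using snoc by (auto simp: staller_play_snoc)
    have "y \<in> dom_claimed \<sigma> (ss @ [x])" if "(x, y) \<in> M" for y
    proof -
      \<comment> \<open>Had Staller claimed \<open>y\<close> earlier, its \<open>M\<close>-neighbour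
        \<open>x\<close> would already belong to Dominator by the induction hypothesis.\<close>
      have "y \<notin> set ss" using IH x Msym[OF that] by blast
      moreover have "y \<noteq> x" using that Mirr by blast
      ultimately show ?thesis using that IH by (auto simp: dom_claimed_snoc \<sigma>_snoc)
    qed
    then show ?case using IH by (auto simp: dom_claimed_snoc)
  qed simp
  show ?thesis
    unfolding dominator_wins_avoiding_def
  proof (intro exI[of _ \<sigma>] conjI allI impI ballI)
    show "dominator_strategy T b \<sigma>"
      unfolding dominator_strategy_def
    proof (intro allI impI conjI; elim conjE)
      fix ss :: "'a list" assume ne: "ss \<noteq> []"
      show "\<sigma> ss \<subseteq> verts T - (set ss \<union> dom_claimed \<sigma> (butlast ss))"
        using dom[of "butlast ss"] MV ne by (auto simp: \<sigma>_def)
      have "card (\<sigma> ss) \<le> card (M `` {last ss})"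
        using ne finM by (intro card_mono) (auto simp: \<sigma>_def)
      then show "card (\<sigma> ss) \<le> b" using deg le_trans by blast
    qed
    show "dom_claimed \<sigma> ss \<subseteq> verts T - A" for ss
      using dom[of ss] MV by blast
    fix ss x
    assume "staller_play T \<sigma> ss \<and> finished T \<sigma> ss" and x: "x \<in> verts T - closed_nbhd T A"
    then have play: "staller_play T \<sigma> ss" and fin: "verts T \<subseteq> set ss \<union> dom_claimed \<sigma> ss"
      by (auto simp: finished_def)
    show "dominated T (dom_claimed \<sigma> ss) x"
    proof (cases "x \<in> dom_claimed \<sigma> ss")
      case False
      \<comment> \<open>At the end of the play an unclaimed vertex does not exist, so Staller owns
        \<open>x\<close> and Dominator owns its \<open>M\<close>-neighbours.\<close>
      then have "x \<in> set ss" using fin x by blast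
      moreover have "x \<in> verts T - A" "nbhd T x \<inter> A = {}"
        using x nbhd_sym by (auto simp: closed_nbhd_def)
      then obtain y where "(x, y) \<in> M" using cov by blast
      moreover from this have "y \<in> nbhd T x" using MT by (auto simp: adj_on_def)
      ultimately show ?thesis using inv[OF play] by (auto simp: dominated_def)
    qed (simp add: dominated_def)
  qed
qed

section \<open>From a winning strategy to goodness\<close>

text \<open>A removed vertex outside the sequence was stripped as a leaf at some \<open>v\<close>,
  its only remaining neighbour, and \<open>v\<close> was deleted with it. That \<open>v\<close> was
  still present follows inductively: otherwise it would have no remaining neighbour, hence no
  leaf.\<close>

lemma removed_isolated:
  assumes "admissible T A b vs" "x \<in> verts T" "x \<notin> rest vs" "x \<notin> set vs"
  shows "nbhd T x \<inter> rest vs = {}"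
  using assms
proof (induction vs arbitrary: x rule: rev_induct)
  case (snoc v vs)
  have adm: "admissible T A b vs" and v: "v \<in> verts T" "v \<notin> set vs" "card (leafs (rest vs) v) = b"
    using snoc.prems by (auto simp: admissible_snoc)
  show ?case
  proof (cases "x \<in> rest vs")
    case True
    then have xl: "x \<in> leafs (rest vs) v" using snoc.prems by (auto simp: strip_def)
    then have "nbhd T v \<inter> rest vs \<noteq> {}" by (auto simp: leafs_def)
    then have "v \<in> rest vs" using snoc.IH[OF adm v(1) _ v(2)] by blast
    then show ?thesis using leafs_nbrs[OF xl] by (auto simp: strip_def)
  next
    case False
    then show ?thesis using snoc.IH[OF adm] snoc.prems strip_subset[of "rest vs" v] by auto
  qed
qed simp

text \<open>A removed neighbour of \<open>w\<close> outside the sequence would have no neighbour in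
  the rest, yet \<open>w\<close> is one. So once Staller owns the sequence and \<open>v\<close>,
  only claiming \<open>w\<close> itself can dominate \<open>w\<close>.\<close>

lemma leafs_rest_nbhd:
  assumes adm: "admissible T A b vs" and v: "v \<in> verts T" "v \<notin> set vs"
    and w: "w \<in> leafs (rest vs) v"
  shows "v \<in> rest vs" "nbhd T w \<subseteq> insert v (set vs)"
proof -
  have wr: "w \<in> rest vs" "w \<in> nbhd T v" using w by (auto simp: leafs_def)
  then show v': "v \<in> rest vs" using removed_isolated[OF adm v(1) _ v(2)] by blast
  show "nbhd T w \<subseteq> insert v (set vs)"
  proof
    fix x assume x: "x \<in> nbhd T w"
    have "w \<in> nbhd T x \<inter> rest vs" using x wr nbhd_sym by blast
    moreover have "x \<in> verts T" using x N_subset by blast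
    ultimately have "x \<in> rest vs \<or> x \<in> set vs" using removed_isolated[OF adm, of x] by blast
    then show "x \<in> insert v (set vs)" using leafs_nbrs[OF w v'] x by blast
  qed
qed

lemma wins_imp_good:
  assumes "dominator_wins_avoiding T A b"
  shows "good T A b"
proof -
  obtain \<sigma> where strat: "dominator_strategy T b \<sigma>"
    and win: "\<And>ss x. staller_play T \<sigma> ss \<Longrightarrow> finished T \<sigma> ss \<Longrightarrow> x \<in> verts T - closed_nbhd T A
      \<Longrightarrow> dominated T (dom_claimed \<sigma> ss) x"
    using assms unfolding dominator_wins_avoiding_def by blast
  have \<sigma>: "\<sigma> (vs @ [v]) \<subseteq> verts T" "card (\<sigma> (vs @ [v])) \<le> b" if "staller_play T \<sigma> (vs @ [v])" for vs v
    using strat that unfolding dominator_strategy_def by blast+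
  \<comment> \<open>If Dominator leaves such a leaf \<open>w\<close> unclaimed, Staller takes it
    next and owns its closed neighbourhood. No vertex of this neighbourhood is in \<open>A\<close>,
    so \<open>w\<close> is one of the vertices to be dominated.\<close>
  have forced: "staller_play T \<sigma> (vs @ [v])" "leafs (rest vs) v \<subseteq> \<sigma> (vs @ [v])"
    if adm: "admissible T A b vs" and play: "staller_play T \<sigma> vs"
      and claimed: "set vs \<union> dom_claimed \<sigma> vs = verts T - rest vs"
      and v: "v \<in> verts T - A - set vs" and ne: "leafs (rest vs) v \<noteq> {}" for vs v
  proof -
    have vr: "v \<in> rest vs" using leafs_rest_nbhd(1)[OF adm] v ne by blast
    then show play': "staller_play T \<sigma> (vs @ [v])"
      using play v claimed by (auto simp: staller_play_snoc)
    show "leafs (rest vs) v \<subseteq> \<sigma> (vs @ [v])"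
    proof (rule subsetI, rule ccontr)
      fix w assume w: "w \<in> leafs (rest vs) v" and "w \<notin> \<sigma> (vs @ [v])"
      have Nw: "nbhd T w \<subseteq> insert v (set vs)" using leafs_rest_nbhd(2)[OF adm _ _ w] v by blast
      have w': "w \<in> rest vs" "w \<notin> A" "w \<noteq> v" using w nbhd_irrefl by (auto simp: leafs_def)
      have "staller_play T \<sigma> ((vs @ [v]) @ [w])"
        unfolding staller_play_snoc[of _ _ "vs @ [v]"] dom_claimed_snoc
        using play' w' claimed \<open>w \<notin> \<sigma> (vs @ [v])\<close> rest_subset[of vs] by auto
      from staller_play_extend[OF finite_verts this] obtain ts
        where ts: "staller_play T \<sigma> (vs @ [v, w] @ ts)" "finished T \<sigma> (vs @ [v, w] @ ts)" by auto
      have "set vs \<inter> A = {}" using adm by (auto simp: admissible_def)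
      then have "nbhd T w \<inter> A = {}" using Nw v by auto
      then have "w \<in> verts T - closed_nbhd T A"
        using w' rest_subset[of vs] nbhd_sym by (auto simp: closed_nbhd_def)
      then have "dominated T (dom_claimed \<sigma> (vs @ [v, w] @ ts)) w" using win[OF ts] by blast
      then show False
        using staller_play_disjoint[OF strat ts(1)] Nw by (auto simp: dominated_def)
    qed
  qed
  \<comment> \<open>Along an admissible sequence Dominator's answers are exactly the stripped
    leaves, so the unclaimed vertices are those of \<open>rest vs\<close>.\<close>
  have line: "staller_play T \<sigma> vs \<and> set vs \<union> dom_claimed \<sigma> vs = verts T - rest vs"
    if "admissible T A b vs" for vs
    using that
  proof (induction vs rule: rev_induct)
    case (snoc v vs)
    have adm: "admissible T A b vs" and v: "v \<in> verts T - A - set vs" "card (leafs (rest vs) v) = b"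
      using snoc.prems by (auto simp: admissible_snoc)
    have IH: "staller_play T \<sigma> vs" "set vs \<union> dom_claimed \<sigma> vs = verts T - rest vs"
      using snoc.IH[OF adm] by auto
    have ne: "leafs (rest vs) v \<noteq> {}" using v b_pos by auto
    note f = forced[OF adm IH v(1) ne]
    have "finite (\<sigma> (vs @ [v]))" using \<sigma>(1)[OF f(1)] by (rule finite_subset) simp
    \<comment> \<open>The answer contains \<open>b\<close> forced leaves and has at most
      \<open>b\<close> elements, so it is equal to the set of leaves.\<close>
    then have "leafs (rest vs) v = \<sigma> (vs @ [v])"
      using f(2) \<sigma>(2)[OF f(1)] v(2) by (intro card_seteq) auto
    then have "set (vs @ [v]) \<union> dom_claimed \<sigma> (vs @ [v])
        = (verts T - rest vs) \<union> insert v (leafs (rest vs) v)"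
      using IH(2) by (auto simp: dom_claimed_snoc)
    also have "\<dots> = verts T - rest (vs @ [v])"
      using v rest_subset[of vs] by (auto simp: strip_def leafs_def)
    finally show ?case using f(1) by blast
  qed simp
  show ?thesis
    unfolding good_def
  proof
    assume "\<exists>vs u. problematic T A b vs u"
    then obtain vs u where adm: "admissible T A b vs" and u: "u \<in> verts T - A - set vs"
      and big: "card (leafs (rest vs) u) \<ge> b + 1"
      by (auto simp: problematic_rest)
    then have ne: "leafs (rest vs) u \<noteq> {}" by auto
    note f = forced[OF adm conjunct1[OF line[OF adm]] conjunct2[OF line[OF adm]] u ne]
    \<comment> \<open>At the last vertex \<open>u\<close> the forced answer would have to contain at
      least \<open>b + 1\<close> leaves.\<close>
    have "finite (\<sigma> (vs @ [u]))" using \<sigma>(1)[OF f(1)] by (rule finite_subset) simp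
    then have "card (leafs (rest vs) u) \<le> b"
      using card_mono[OF _ f(2)] \<sigma>(2)[OF f(1)] by linarith
    then show False using big by simp
  qed
qed

end

theorem theorem4p2:
  fixes T :: "('a, 'b) pre_digraph" and A :: "'a set" and b :: nat
  assumes "b \<ge> 1"
    and "is_tree T"
    and "card (verts T) \<ge> 2"
    and "A \<subseteq> verts T"
  shows "dominator_wins_avoiding T A b \<longleftrightarrow> good T A b"
proof -
  interpret avoiding_game T A b by unfold_locales (use assms in auto)
  show ?thesis using wins_imp_good good_imp_edge_cover edge_cover_imp_wins by blast
qed

end
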